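(* For any (fixed) odd integer $d>2$, the random graph $G_{n,d}$ is not a.a.s. $(d-1)/2$-resilient with respect to Hamiltonicity; that is, the probability that $G_{n,d}$ is $(d-1)/2$-resilient with respect to Hamiltonicity does not tend to $1$ as $n\to\infty$.
   Context: All graphs are simple and undirected. For $n,d\in\mathbb{N}$ with $d<n$ and $nd$ even, $G_{n,d}$ denotes a graph chosen uniformly at random from the set of all $d$-regular graphs on vertex set $[n]=\{1,\dots,n\}$; using this notation implicitly assumes $nd$ even (so limits are over $n$ with $nd$ even). An event holds a.a.s. if its probability tends to $1$ as $n\to\infty$. For $H\subseteq G$ (a spanning subgraph), $G\setminus H$ is the graph on $V(G)$ with edge set $E(G)\setminus E(H)$, and $\Delta(H)$ is the maximum degree of $H$. The local resilience of a graph $G$ with respect to a property $\mathcal{P}$ is the maximum number $r\in\mathbb{N}$ such that, for all $H\subseteq G$ with $\Delta(H)<r$, the graph $G\setminus H$ satisfies $\mathcal{P}$. $G$ is $r$-resilient with respect to $\mathcal{P}$ if the local resilience of $G$ is greater than $r$; that is, $G\setminus H$ satisfies $\mathcal{P}$ for every $H\subseteq G$ with $\Delta(H)\leq r$. Hamiltonicity is the property of containing a cycle that covers all vertices. *)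

theory Defs
  imports "HOL-Probability.Probability"
begin

type_synonym 'a ugraph = "'a set \<times> 'a set set"

abbreviation verts :: "'a ugraph \<Rightarrow> 'a set" where "verts \<equiv> fst"
abbreviation edges :: "'a ugraph \<Rightarrow> 'a set set" where "edges \<equiv> snd"

definition simple_graph :: "'a ugraph \<Rightarrow> bool" where
  "simple_graph G \<longleftrightarrow> finite (verts G) \<and> edges G \<subseteq> {e. e \<subseteq> verts G \<and> card e = 2}"

definition vertex_degree :: "'a ugraph \<Rightarrow> 'a \<Rightarrow> nat" where
  "vertex_degree G v = card {e \<in> edges G. v \<in> e}"

(* Unspecified for the graph without vertices. *)
definition max_degree :: "'a ugraph \<Rightarrow> nat" where
  "max_degree G = (MAX v\<in>verts G. vertex_degree G v)"

definition spanning_subgraph :: "'a ugraph \<Rightarrow> 'a ugraph \<Rightarrow> bool" where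
  "spanning_subgraph H G \<longleftrightarrow> verts H = verts G \<and> edges H \<subseteq> edges G"

definition delete_edges :: "'a ugraph \<Rightarrow> 'a ugraph \<Rightarrow> 'a ugraph" where
  "delete_edges G H = (verts G, edges G - edges H)"

definition is_cycle :: "'a ugraph \<Rightarrow> 'a list \<Rightarrow> bool" where
  "is_cycle G c \<longleftrightarrow> 3 \<le> length c \<and> distinct c \<and> set c \<subseteq> verts G \<and>
     (\<forall>i < length c. {c ! i, c ! (Suc i mod length c)} \<in> edges G)"

definition hamiltonian :: "'a ugraph \<Rightarrow> bool" where
  "hamiltonian G \<longleftrightarrow> (\<exists>c. is_cycle G c \<and> set c = verts G)"

(* The supremum is taken in enat, so that it is \<infinity> when every value of r qualifies.
   Otherwise it is the maximum: r = 0 always qualifies, and the set of qualifying r is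
   downward closed. *)
definition local_resilience :: "('a ugraph \<Rightarrow> bool) \<Rightarrow> 'a ugraph \<Rightarrow> enat" where
  "local_resilience P G =
     (SUP r \<in> {r. \<forall>H. spanning_subgraph H G \<and> max_degree H < r \<longrightarrow> P (delete_edges G H)}. enat r)"

definition resilient :: "nat \<Rightarrow> ('a ugraph \<Rightarrow> bool) \<Rightarrow> 'a ugraph \<Rightarrow> bool" where
  "resilient r P G \<longleftrightarrow> enat r < local_resilience P G"

lemma resilient_iff:
  "resilient r P G \<longleftrightarrow>
     (\<forall>H. spanning_subgraph H G \<and> max_degree H \<le> r \<longrightarrow> P (delete_edges G H))"
proof
  assume "resilient r P G"
  then obtain s where "r < s"
    and "\<forall>H. spanning_subgraph H G \<and> max_degree H < s \<longrightarrow> P (delete_edges G H)"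
    by (auto simp: resilient_def local_resilience_def less_SUP_iff)
  then show "\<forall>H. spanning_subgraph H G \<and> max_degree H \<le> r \<longrightarrow> P (delete_edges G H)"
    by auto
next
  assume "\<forall>H. spanning_subgraph H G \<and> max_degree H \<le> r \<longrightarrow> P (delete_edges G H)"
  then show "resilient r P G"
    unfolding resilient_def local_resilience_def less_SUP_iff
    by (intro bexI[of _ "Suc r"]) (auto simp: less_Suc_eq_le)
qed

definition regular_graphs :: "nat \<Rightarrow> nat \<Rightarrow> nat ugraph set" where
  "regular_graphs n d =
     {G. simple_graph G \<and> verts G = {1..n} \<and> (\<forall>v \<in> verts G. vertex_degree G v = d)}"

lemma finite_regular_graphs: "finite (regular_graphs n d)"
proof (rule finite_subset)
  show "regular_graphs n d \<subseteq> {{1..n}} \<times> Pow (Pow {1..n})"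
    unfolding regular_graphs_def simple_graph_def by fastforce
qed simp

(* Meaningful only if regular_graphs n d is nonempty, which is the case when d < n and n * d is even. *)
definition random_regular_graph :: "nat \<Rightarrow> nat \<Rightarrow> nat ugraph pmf" where
  "random_regular_graph n d = pmf_of_set (regular_graphs n d)"

(* n tends to infinity through the values for which d-regular graphs on {1..n} exist. *)
definition admissible_sizes :: "nat \<Rightarrow> nat filter" where
  "admissible_sizes d = inf sequentially (principal {n. d < n \<and> even (n * d)})"

lemma admissible_sizes_neq_bot: "admissible_sizes d \<noteq> bot"
proof
  assume "admissible_sizes d = bot"
  then have "\<forall>\<^sub>F n in sequentially. \<not> (d < n \<and> even (n * d))"
    by (simp add: admissible_sizes_def trivial_limit_def eventually_inf_principal)
  then obtain N where N: "\<And>n. N \<le> n \<Longrightarrow> \<not> (d < n \<and> even (n * d))"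
    by (auto simp: eventually_sequentially)
  show False using N[of "2 * (N + d + 1)"] by simp
qed

definition aas :: "nat \<Rightarrow> (nat ugraph \<Rightarrow> bool) \<Rightarrow> bool" where
  "aas d Q \<longleftrightarrow>
     ((\<lambda>n. measure_pmf.prob (random_regular_graph n d) {G. Q G}) \<longlongrightarrow> 1) (admissible_sizes d)"

end

theory Submission
  imports Defs
begin

text \<open>
  Let \<open>d = 2 * k + 1\<close>. If more than half of the vertices form a set \<open>A\<close> in which every vertex has at
  most \<open>k\<close> neighbours, then deleting the edges inside \<open>A\<close> destroys all Hamilton cycles. Both sides of
  a maximum cut have this property, so a resilient graph is balanced: both sides have exactly half of
  the vertices. Choose such a side \<open>A\<close> and a vertex \<open>u\<close> outside it. A switching that replaces two
  edges \<open>u x\<close>, \<open>y z\<close> with \<open>x \<in> A\<close>, \<open>z \<notin> A\<close> by \<open>u z\<close>, \<open>x y\<close> decreases the number of neighbours of \<open>u\<close>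
  in \<open>A\<close>; after at most \<open>d\<close> of them \<open>A \<union> {u}\<close> witnesses that the graph is not resilient.
  For linearly many \<open>u\<close>, every step has linearly many choices, whereas
  undoing a step also leaves only linearly many choices. Hence a positive proportion of all
  \<open>d\<close>-regular graphs is not resilient.
\<close>

section \<open>Neighbourhoods\<close>

definition nbrs :: "'a ugraph \<Rightarrow> 'a \<Rightarrow> 'a set" where
  "nbrs G v = {w. {v, w} \<in> edges G}"

lemma mem_nbrs_iff: "w \<in> nbrs G v \<longleftrightarrow> {v, w} \<in> edges G"
  by (simp add: nbrs_def)

lemma nbrs_sym: "w \<in> nbrs G v \<longleftrightarrow> v \<in> nbrs G w"
  by (simp add: nbrs_def insert_commute)

lemma not_in_nbrs_self: "simple_graph G \<Longrightarrow> v \<notin> nbrs G v"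
  by (auto simp: nbrs_def simple_graph_def)

lemma nbrs_subset_verts: "simple_graph G \<Longrightarrow> nbrs G v \<subseteq> verts G"
  by (auto simp: nbrs_def simple_graph_def)

lemma finite_nbrs: "simple_graph G \<Longrightarrow> finite (nbrs G v)"
  by (meson finite_subset nbrs_subset_verts simple_graph_def)

lemma vertex_degree_eq_card_nbrs:
  assumes "simple_graph G"
  shows "vertex_degree G v = card (nbrs G v)"
proof -
  have "bij_betw (\<lambda>w. {v, w}) (nbrs G v) {e \<in> edges G. v \<in> e}"
    unfolding bij_betw_def
  proof
    show "inj_on (\<lambda>w. {v, w}) (nbrs G v)"
      by (auto simp: inj_on_def doubleton_eq_iff)
    show "(\<lambda>w. {v, w}) ` nbrs G v = {e \<in> edges G. v \<in> e}"
    proof (intro equalityI subsetI)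
      fix e assume e: "e \<in> {e \<in> edges G. v \<in> e}"
      with assms have "card e = 2" by (auto simp: simple_graph_def)
      then obtain a b where "e = {a, b}" by (auto simp: card_2_iff)
      with e show "e \<in> (\<lambda>w. {v, w}) ` nbrs G v"
        by (auto simp: nbrs_def insert_commute)
    qed (auto simp: nbrs_def)
  qed
  then show ?thesis by (simp add: vertex_degree_def bij_betw_same_card)
qed

definition regular :: "nat \<Rightarrow> 'a ugraph \<Rightarrow> bool" where
  "regular d G \<longleftrightarrow> simple_graph G \<and> (\<forall>v \<in> verts G. card (nbrs G v) = d)"

lemma regular_graphs_eq: "regular_graphs n d = {G. regular d G \<and> verts G = {1..n}}"
  by (auto simp: regular_graphs_def regular_def vertex_degree_eq_card_nbrs)

section \<open>Vertex sets of small induced degree\<close>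

definition sparse_set :: "nat \<Rightarrow> 'a ugraph \<Rightarrow> 'a set \<Rightarrow> bool" where
  "sparse_set k G A \<longleftrightarrow> A \<subseteq> verts G \<and> (\<forall>v \<in> A. card (nbrs G v \<inter> A) \<le> k)"

text \<open>Passing to the cyclic successor maps the positions of \<open>A\<close> injectively to
  positions outside \<open>A\<close>.\<close>

lemma hamiltonian_independent_set:
  assumes ham: "hamiltonian G" and A: "A \<subseteq> verts G" "\<And>v. v \<in> A \<Longrightarrow> nbrs G v \<inter> A = {}"
  shows "2 * card A \<le> card (verts G)"
proof -
  obtain c where c: "is_cycle G c" "set c = verts G"
    using ham by (auto simp: hamiltonian_def)
  define l where "l = length c"
  define next_idx where "next_idx i = Suc i mod l" for i
  define I where "I = {i. i < l \<and> c ! i \<in> A}"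
  have l: "3 \<le> l" "distinct c" "\<And>i. i < l \<Longrightarrow> c ! next_idx i \<in> nbrs G (c ! i)"
    using c(1) by (auto simp: is_cycle_def l_def next_idx_def mem_nbrs_iff)
  have "bij_betw (\<lambda>i. c ! i) I A"
    unfolding bij_betw_def
  proof
    show "inj_on (\<lambda>i. c ! i) I"
      using l(2) by (auto simp: inj_on_def I_def l_def nth_eq_iff_index_eq)
    show "(\<lambda>i. c ! i) ` I = A"
      using A(1) c(2) by (auto simp: I_def l_def in_set_conv_nth image_iff; metis in_set_conv_nth subsetD)
  qed
  then have cardI: "card I = card A" by (rule bij_betw_same_card)
  have "inj_on next_idx I"
  proof (rule inj_onI)
    fix i j assume "i \<in> I" "j \<in> I" and eq: "next_idx i = next_idx j"
    then have "i < l" "j < l" by (auto simp: I_def)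
    then show "i = j"
      using eq unfolding next_idx_def
      by (cases "Suc i = l"; cases "Suc j = l") (auto simp: mod_less)
  qed
  moreover have "next_idx ` I \<subseteq> {..<l} - I"
  proof
    fix j assume "j \<in> next_idx ` I"
    then obtain i where i: "i < l" "c ! i \<in> A" "j = next_idx i" by (auto simp: I_def)
    have "c ! j \<notin> A" using l(3)[OF i(1)] A(2)[OF i(2)] i(3) by auto
    moreover have "j < l" using i l(1) by (simp add: next_idx_def)
    ultimately show "j \<in> {..<l} - I" by (simp add: I_def)
  qed
  ultimately have "card I \<le> card ({..<l} - I)"
    by (metis card_inj_on_le finite_Diff finite_lessThan)
  also have "\<dots> = l - card I"
    by (subst card_Diff_subset) (auto simp: I_def)
  finally have "2 * card I \<le> l"
    using card_mono[of "{..<l}" I] by (auto simp: I_def)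
  moreover have "l = card (verts G)"
    using c(2) distinct_card[OF l(2)] by (simp add: l_def)
  ultimately show ?thesis using cardI by simp
qed

text \<open>Deleting the edges inside \<open>A\<close> costs each vertex at most \<open>k\<close>
  edges and leaves an independent set of more than half of the vertices.\<close>

lemma not_resilient_if_large_sparse_set:
  assumes G: "simple_graph G" and A: "sparse_set k G A" and large: "card (verts G) < 2 * card A"
  shows "\<not> resilient k hamiltonian G"
proof
  assume res: "resilient k hamiltonian G"
  define H where "H = (verts G, {e \<in> edges G. e \<subseteq> A})"
  have AV: "A \<subseteq> verts G" using A by (simp add: sparse_set_def)
  have H: "simple_graph H" "verts H = verts G"
    using G by (auto simp: H_def simple_graph_def)
  have "vertex_degree H v \<le> k" for v
  proof (cases "v \<in> A")
    case True
    then have "nbrs H v = nbrs G v \<inter> A" by (auto simp: H_def nbrs_def)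
    then show ?thesis using A True H by (simp add: vertex_degree_eq_card_nbrs sparse_set_def)
  next
    case False
    then have "nbrs H v = {}" by (auto simp: H_def nbrs_def)
    then show ?thesis using H by (simp add: vertex_degree_eq_card_nbrs)
  qed
  \<comment> \<open>\<open>max_degree\<close> is a \<open>Max\<close> over the vertices, hence
    unspecified on an empty vertex set.\<close>
  moreover have "finite (verts G)" "verts G \<noteq> {}"
    using G AV large by (auto simp: simple_graph_def)
  ultimately have "max_degree H \<le> k"
    using H(2) by (simp add: max_degree_def)
  moreover have "spanning_subgraph H G"
    by (auto simp: spanning_subgraph_def H_def)
  ultimately have "hamiltonian (delete_edges G H)"
    using res unfolding resilient_iff by blast
  moreover have "nbrs (delete_edges G H) v \<inter> A = {}" if "v \<in> A" for v
    using that by (auto simp: delete_edges_def H_def nbrs_def)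
  ultimately have "2 * card A \<le> card (verts (delete_edges G H))"
    using AV by (intro hamiltonian_independent_set) (auto simp: delete_edges_def)
  then show False using large by (simp add: delete_edges_def)
qed

section \<open>Maximum cuts\<close>

definition cut :: "'a ugraph \<Rightarrow> 'a set \<Rightarrow> ('a \<times> 'a) set" where
  "cut G A = {(a, b). a \<in> A \<and> b \<in> verts G - A \<and> b \<in> nbrs G a}"

text \<open>Moving \<open>v\<close> out of \<open>A\<close> cannot enlarge a maximum cut, so at most
  half of the edges at \<open>v\<close> lead into \<open>A\<close>. The degree is odd, which leaves
  at most \<open>k\<close> of them.\<close>

lemma max_cut_sparse:
  assumes G: "regular (2 * k + 1) G" and A: "A \<subseteq> verts G"
    and max: "\<And>B. B \<subseteq> verts G \<Longrightarrow> card (cut G B) \<le> card (cut G A)"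
  shows "sparse_set k G A"
  unfolding sparse_set_def
proof (intro conjI ballI A)
  fix v assume v: "v \<in> A"
  have sG: "simple_graph G" and deg: "card (nbrs G v) = 2 * k + 1"
    using G A v by (auto simp: regular_def)
  note fin = finite_nbrs[OF sG] and self = not_in_nbrs_self[OF sG]
  have "finite (verts G)" using sG by (simp add: simple_graph_def)
  then have fcut: "finite (cut G A)"
    using A by (intro finite_subset[of "cut G A" "verts G \<times> verts G"]) (auto simp: cut_def)
  \<comment> \<open>The move loses the pairs \<open>?old\<close> and gains \<open>?new\<close>. Cut
    edges are oriented out of the set, hence the different positions of \<open>v\<close>.\<close>
  let ?old = "{v} \<times> (nbrs G v - A)" and ?new = "(nbrs G v \<inter> A) \<times> {v}"
  have eq: "cut G (A - {v}) = (cut G A - ?old) \<union> ?new"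
    using v A self[of v] nbrs_subset_verts[OF sG, of v]
    by (auto simp: cut_def) (use nbrs_sym in fastforce)+
  have "card (cut G (A - {v})) = card (cut G A - ?old) + card ?new"
    unfolding eq using fcut fin v by (intro card_Un_disjoint) (auto simp: cut_def)
  also have "card (cut G A - ?old) = card (cut G A) - card ?old"
    using fin v nbrs_subset_verts[OF sG, of v]
    by (intro card_Diff_subset) (auto simp: cut_def)
  finally have "card (cut G (A - {v})) = card (cut G A) - card (nbrs G v - A) + card (nbrs G v \<inter> A)"
    by (simp add: card_cartesian_product)
  \<comment> \<open>This makes the truncated subtraction above exact.\<close>
  moreover have "card ?old \<le> card (cut G A)"
    using fcut v nbrs_subset_verts[OF sG, of v] by (intro card_mono) (auto simp: cut_def)
  then have "card (nbrs G v - A) \<le> card (cut G A)"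
    by (simp add: card_cartesian_product)
  moreover have "card (cut G (A - {v})) \<le> card (cut G A)"
    using A by (intro max) auto
  ultimately have "card (nbrs G v \<inter> A) \<le> card (nbrs G v - A)" by linarith
  moreover have "card (nbrs G v \<inter> A) + card (nbrs G v - A) = 2 * k + 1"
    using card_Int_Diff[OF fin, of v A] deg by simp
  ultimately show "card (nbrs G v \<inter> A) \<le> k" by simp
qed

lemma ex_sparse_bipartition:
  assumes G: "regular (2 * k + 1) G"
  obtains A where "A \<subseteq> verts G" "sparse_set k G A" "sparse_set k G (verts G - A)"
proof -
  have fin: "finite (verts G)" using G by (auto simp: regular_def simple_graph_def)
  obtain A where A: "A \<subseteq> verts G"
    and max: "\<And>B. B \<subseteq> verts G \<Longrightarrow> card (cut G B) \<le> card (cut G A)"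
  proof -
    have "Max ((\<lambda>B. card (cut G B)) ` Pow (verts G)) \<in> (\<lambda>B. card (cut G B)) ` Pow (verts G)"
      using fin by (intro Max_in) auto
    then obtain A where A: "A \<subseteq> verts G"
      "card (cut G A) = Max ((\<lambda>B. card (cut G B)) ` Pow (verts G))"
      by auto
    show ?thesis
      by (rule that[OF A(1)]) (use A(2) fin in auto)
  qed
  \<comment> \<open>The complement has the reversed cut, so it is a maximum as well.\<close>
  have "cut G (verts G - A) = (cut G A)\<inverse>"
    using A nbrs_sym[of _ G] by (auto simp: cut_def)
  then have "card (cut G (verts G - A)) = card (cut G A)"
    by (simp add: card_inverse)
  then have "sparse_set k G (verts G - A)"
    using max by (intro max_cut_sparse[OF G]) auto
  with A max_cut_sparse[OF G A max] show ?thesis using that by blast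
qed

section \<open>Switchings\<close>

text \<open>In the 4-cycle through \<open>u\<close>, \<open>x\<close>, \<open>y\<close>,
  \<open>z\<close>, one perfect matching replaces the other; under \<open>switchable\<close> this
  keeps all degrees.\<close>

definition switch :: "'a ugraph \<Rightarrow> 'a \<Rightarrow> 'a \<Rightarrow> 'a \<Rightarrow> 'a \<Rightarrow> 'a ugraph" where
  "switch G u x y z = (verts G, (edges G - {{u, x}, {y, z}}) \<union> {{u, z}, {x, y}})"

definition switchable :: "'a ugraph \<Rightarrow> 'a \<Rightarrow> 'a \<Rightarrow> 'a \<Rightarrow> 'a \<Rightarrow> bool" where
  "switchable G u x y z \<longleftrightarrow> distinct [u, x, y, z] \<and>
     x \<in> nbrs G u \<and> z \<in> nbrs G y \<and> z \<notin> nbrs G u \<and> y \<notin> nbrs G x"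

lemma verts_switch [simp]: "verts (switch G u x y z) = verts G"
  by (simp add: switch_def)

text \<open>The reverse step is again a switching, with \<open>x\<close> and \<open>z\<close>
  interchanged. It recovers \<open>G\<close> from the switched graph and the four vertices.\<close>

lemma switch_switch:
  assumes "switchable G u x y z"
  shows "switch (switch G u x y z) u z y x = G"
  using assms unfolding switchable_def switch_def mem_nbrs_iff
  by (cases G) (auto simp: insert_commute doubleton_eq_iff)

lemma nbrs_switch:
  assumes "switchable G u x y z"
  shows "nbrs (switch G u x y z) u = insert z (nbrs G u - {x})"
    and "nbrs (switch G u x y z) x = insert y (nbrs G x - {u})"
    and "nbrs (switch G u x y z) y = insert x (nbrs G y - {z})"
    and "nbrs (switch G u x y z) z = insert u (nbrs G z - {y})"
    and "v \<notin> {u, x, y, z} \<Longrightarrow> nbrs (switch G u x y z) v = nbrs G v"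
  using assms unfolding switchable_def
  by (auto simp: switch_def nbrs_def doubleton_eq_iff insert_commute)

lemma regular_switch:
  assumes G: "regular d G" and sw: "switchable G u x y z"
  shows "regular d (switch G u x y z)"
proof -
  have sG: "simple_graph G" using G by (simp add: regular_def)
  note fin = finite_nbrs[OF sG]
  have V: "u \<in> verts G" "x \<in> verts G" "y \<in> verts G" "z \<in> verts G"
    using sw nbrs_subset_verts[OF sG] nbrs_sym[of _ G] unfolding switchable_def by blast+
  have "simple_graph (switch G u x y z)"
    using sG V sw by (auto simp: simple_graph_def switch_def switchable_def)
  moreover have "card (nbrs (switch G u x y z) v) = card (nbrs G v)" for v
  proof -
    have replace: "card (insert b (S - {a})) = card S" if "finite S" "a \<in> S" "b \<notin> S" for a b :: 'a and S
      using that card_Suc_Diff1[of S a] by simp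
    have "u \<in> nbrs G x" "z \<notin> nbrs G u" "u \<notin> nbrs G z" "x \<notin> nbrs G y" "y \<in> nbrs G z"
      using sw nbrs_sym[of _ G] unfolding switchable_def by blast+
    with sw show ?thesis
      by (cases "v \<in> {u, x, y, z}")
        (auto simp: nbrs_switch[OF sw] switchable_def intro!: replace fin)
  qed
  ultimately show ?thesis using G by (simp add: regular_def)
qed

section \<open>Vertices a few switchings away from a large sparse set\<close>

definition outer_active :: "'a ugraph \<Rightarrow> 'a set \<Rightarrow> 'a set" where
  "outer_active G A = {y \<in> verts G - A. nbrs G y - A \<noteq> {}}"

definition slack :: "nat \<Rightarrow> 'a ugraph \<Rightarrow> 'a set \<Rightarrow> 'a set" where
  "slack k G A = {y \<in> A. card (nbrs G y \<inter> A) < k}"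

text \<open>
  The pair of \<open>G\<close> and \<open>u\<close> is at most \<open>j\<close> switchings away from a graph that is not resilient. The
  last conjunct provides candidates for the vertex \<open>y\<close>: for \<open>y \<notin> A\<close> a switching does not increase
  any degree inside \<open>A\<close>, while for \<open>y \<in> A\<close> it adds the edge \<open>x y\<close> there, so \<open>x\<close> and \<open>y\<close> both need slack.
\<close>
definition reducible :: "nat \<Rightarrow> nat \<Rightarrow> nat \<Rightarrow> 'a ugraph \<Rightarrow> 'a \<Rightarrow> bool" where
  "reducible k m j G u \<longleftrightarrow> (\<exists>A. sparse_set k G A \<and> 2 * card A = card (verts G) \<and>
     u \<in> verts G - A \<and> card (nbrs G u \<inter> A) \<le> j \<and>
     (m \<le> card (outer_active G A) \<or> m \<le> card (slack k G A) \<and> nbrs G u \<inter> A \<subseteq> slack k G A))"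

lemma reducible_mono: "reducible k m j G u \<Longrightarrow> m' \<le> m \<Longrightarrow> j \<le> j' \<Longrightarrow> reducible k m' j' G u"
  unfolding reducible_def by (meson le_trans)

text \<open>A vertex \<open>u\<close> without neighbours in \<open>A\<close> can join
  \<open>A\<close> without raising a degree inside it, and one vertex beyond half suffices.\<close>

lemma not_resilient_if_reducible_0:
  assumes G: "simple_graph G" and red: "reducible k m 0 G u"
  shows "\<not> resilient k hamiltonian G"
proof -
  obtain A where A: "sparse_set k G A" "2 * card A = card (verts G)" "u \<in> verts G - A"
    and "card (nbrs G u \<inter> A) = 0"
    using red by (auto simp: reducible_def)
  then have disj: "nbrs G u \<inter> A = {}"
    using finite_nbrs[OF G, of u] by simp
  have fA: "finite A"
    using G A(1) by (auto simp: sparse_set_def simple_graph_def intro: finite_subset)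
  have "nbrs G v \<inter> insert u A = nbrs G v \<inter> A" if "v \<in> A" for v
    using disj that nbrs_sym[of u G v] by auto
  moreover have "nbrs G u \<inter> insert u A = {}"
    using disj not_in_nbrs_self[OF G, of u] by auto
  ultimately have "sparse_set k G (insert u A)"
    using A(1,3) by (auto simp: sparse_set_def)
  moreover have "card (verts G) < 2 * card (insert u A)"
    using A(2,3) fA by simp
  ultimately show ?thesis by (rule not_resilient_if_large_sparse_set[OF G])
qed

lemma card_two_ball_le:
  assumes G: "regular d G" and u: "u \<in> verts G"
  shows "card (insert u (nbrs G u \<union> (\<Union>v \<in> nbrs G u. nbrs G v))) \<le> 1 + d + d * d"
proof -
  have sG: "simple_graph G" and deg: "\<And>v. v \<in> verts G \<Longrightarrow> card (nbrs G v) = d"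
    using G by (auto simp: regular_def)
  note fin = finite_nbrs[OF sG] and sub = nbrs_subset_verts[OF sG]
  have "card (\<Union>v \<in> nbrs G u. nbrs G v) \<le> (\<Sum>v \<in> nbrs G u. card (nbrs G v))"
    by (rule card_UN_le[OF fin])
  also have "\<dots> = (\<Sum>v \<in> nbrs G u. d)"
    using deg sub by (intro sum.cong) auto
  finally have "card (\<Union>v \<in> nbrs G u. nbrs G v) \<le> d * d" using deg[OF u] by simp
  then have "card (nbrs G u \<union> (\<Union>v \<in> nbrs G u. nbrs G v)) \<le> d + d * d"
    using card_Un_le[of "nbrs G u" "\<Union>v \<in> nbrs G u. nbrs G v"] deg[OF u] by linarith
  then show ?thesis
    using card_insert_le_m1 fin
    by (subst card_insert_if) (auto simp: le_SucI)
qed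

text \<open>The set \<open>A\<close> is kept. A switching alters only four neighbourhoods, so
  \<open>m + 4\<close> potential candidates leave at least \<open>m\<close> for the next step. The
  summand added to \<open>card Y\<close> bounds the vertices within distance 2 of \<open>u\<close>,
  which are avoided.\<close>

lemma reducible_step:
  assumes G: "regular (2 * k + 1) G" and red: "reducible k (m + 4) (Suc j) G u"
    and not_red: "\<not> reducible k m j G u"
  obtains x Y where "finite Y"
    and "m \<le> card Y + (1 + (2 * k + 1) + (2 * k + 1) * (2 * k + 1))"
    and "\<And>y. y \<in> Y \<Longrightarrow> \<exists>z. switchable G u x y z \<and> reducible k m j (switch G u x y z) u"
proof -
  have sG: "simple_graph G" and deg: "\<And>v. v \<in> verts G \<Longrightarrow> card (nbrs G v) = 2 * k + 1"
    using G by (auto simp: regular_def)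
  note fin = finite_nbrs[OF sG] and sub = nbrs_subset_verts[OF sG]
    and self = not_in_nbrs_self[OF sG]
  obtain A where A: "sparse_set k G A" "2 * card A = card (verts G)" "u \<in> verts G - A"
    "card (nbrs G u \<inter> A) \<le> Suc j"
    and active: "m + 4 \<le> card (outer_active G A) \<or>
      m + 4 \<le> card (slack k G A) \<and> nbrs G u \<inter> A \<subseteq> slack k G A"
    using red unfolding reducible_def by blast
  have AV: "A \<subseteq> verts G" using A(1) by (simp add: sparse_set_def)
  have fV: "finite (verts G)" using sG by (simp add: simple_graph_def)
  then have fA: "finite A" using AV by (rule rev_finite_subset)
  \<comment> \<open>With fewer neighbours in \<open>A\<close>, the same \<open>A\<close> would
    already witness level \<open>j\<close>. The count is positive, which provides
    \<open>x\<close>.\<close>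
  have card_u: "card (nbrs G u \<inter> A) = Suc j"
  proof (rule ccontr)
    assume "card (nbrs G u \<inter> A) \<noteq> Suc j"
    then have "card (nbrs G u \<inter> A) \<le> j" using A(4) by simp
    moreover have "m \<le> card (outer_active G A) \<or>
      m \<le> card (slack k G A) \<and> nbrs G u \<inter> A \<subseteq> slack k G A" using active by auto
    ultimately have "reducible k m j G u"
      unfolding reducible_def using A by blast
    with not_red show False by contradiction
  qed
  then have "nbrs G u \<inter> A \<noteq> {}" by auto
  then obtain x where x: "x \<in> nbrs G u" "x \<in> A" by blast
  \<comment> \<open>Choosing \<open>y\<close> outside this ball ensures that \<open>y\<close> is not adjacent to \<open>x\<close>, nor any \<open>z \<in> nbrs G y\<close> to \<open>u\<close>.\<close>
  define ball where "ball = insert u (nbrs G u \<union> (\<Union>v \<in> nbrs G u. nbrs G v))"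
  \<comment> \<open>All candidates come from one source: they lie in \<open>A\<close> exactly when
    the slack alternative is used.\<close>
  define Y0 where "Y0 = (if m + 4 \<le> card (outer_active G A) then outer_active G A else slack k G A)"
  have fY0: "finite Y0"
    using fV fA by (auto simp: Y0_def outer_active_def slack_def)
  have "finite ball" using fin by (auto simp: ball_def)
  then have "card Y0 - card ball \<le> card (Y0 - ball)"
    by (rule diff_card_le_card_Diff)
  moreover have "m + 4 \<le> card Y0" using active by (auto simp: Y0_def)
  moreover have "card ball \<le> 1 + (2 * k + 1) + (2 * k + 1) * (2 * k + 1)"
    unfolding ball_def using A(3) by (intro card_two_ball_le[OF G]) auto
  ultimately have "m \<le> card (Y0 - ball) + (1 + (2 * k + 1) + (2 * k + 1) * (2 * k + 1))"
    by linarith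
  moreover have "\<exists>z. switchable G u x y z \<and> reducible k m j (switch G u x y z) u"
    if y: "y \<in> Y0 - ball" for y
  proof -
    have yV: "y \<in> verts G"
      using y AV by (auto simp: Y0_def outer_active_def slack_def split: if_splits)
    have slack_case: "y \<in> A \<Longrightarrow> y \<in> slack k G A \<and> nbrs G u \<inter> A \<subseteq> slack k G A \<and> m + 4 \<le> card (slack k G A)"
      using y active by (auto simp: Y0_def outer_active_def split: if_splits)
    have outer_case: "y \<notin> A \<Longrightarrow> m + 4 \<le> card (outer_active G A)"
      using y by (auto simp: Y0_def slack_def split: if_splits)
    \<comment> \<open>The new neighbour \<open>z\<close> of \<open>u\<close> has to lie outside
      \<open>A\<close>. For \<open>y\<close> in \<open>A\<close> it exists since fewer than
      \<open>k\<close> of the \<open>2 * k + 1\<close> neighbours of \<open>y\<close> are in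
      \<open>A\<close>.\<close>
    have "nbrs G y - A \<noteq> {}"
    proof (cases "y \<in> A")
      case True
      then have "card (nbrs G y \<inter> A) < k" using slack_case by (simp add: slack_def)
      then have "nbrs G y \<inter> A \<noteq> nbrs G y" using deg[OF yV] by auto
      then show ?thesis by blast
    next
      case False
      then show ?thesis
        using y by (auto simp: Y0_def outer_active_def slack_def split: if_splits)
    qed
    then obtain z where z: "z \<in> nbrs G y" "z \<notin> A" by blast
    have zu: "z \<notin> nbrs G u" "z \<noteq> u" and yx: "y \<noteq> x" "y \<notin> nbrs G x" and yu: "y \<noteq> u" "y \<notin> nbrs G u"
      using y z x nbrs_sym[of _ G] by (auto simp: ball_def)
    have sw: "switchable G u x y z"
      using zu yx yu x z self A(3) unfolding switchable_def by auto
    let ?G = "switch G u x y z"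
    note nb = nbrs_switch[OF sw]
    have u_eq: "nbrs ?G u \<inter> A = nbrs G u \<inter> A - {x}"
      using z nb(1) by auto
    have "sparse_set k ?G A"
      unfolding sparse_set_def
    proof (intro conjI ballI)
      fix v assume v: "v \<in> A"
      then have v_le: "card (nbrs G v \<inter> A) \<le> k" using A(1) by (simp add: sparse_set_def)
      consider "v = x" "y \<in> A" | "v = x" "y \<notin> A" | "v = y" | "v \<notin> {u, x, y, z}"
        using v A(3) z by auto
      then show "card (nbrs ?G v \<inter> A) \<le> k"
      proof cases
        case 1
        have "card (nbrs G x \<inter> A) < k" using slack_case[OF 1(2)] x by (auto simp: slack_def)
        moreover have "nbrs ?G v \<inter> A = insert y (nbrs G x \<inter> A)"
          using 1 nb(2) A(3) by auto
        ultimately show ?thesis using fin by (simp add: card_insert_if)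
      next
        case 2
        then have "nbrs ?G v \<inter> A = nbrs G v \<inter> A" using nb(2) A(3) by auto
        then show ?thesis using v_le by simp
      next
        case 3
        have "card (nbrs G y \<inter> A) < k" using slack_case v 3 by (auto simp: slack_def)
        moreover have "nbrs ?G v \<inter> A = insert x (nbrs G y \<inter> A)"
          using 3 nb(3) x z by auto
        ultimately show ?thesis using fin by (simp add: card_insert_if)
      next
        case 4
        then show ?thesis using nb(5) v_le by simp
      qed
    qed (use AV in simp)
    moreover have "card (nbrs ?G u \<inter> A) \<le> j"
      using card_u x fin by (simp add: u_eq)
    moreover have card_Diff_four: "m \<le> card T"
      if "m + 4 \<le> card S" "S - {u, x, y, z} \<subseteq> T" "finite T" for S T :: "'a set"
    proof -
      have "card S - card {u, x, y, z} \<le> card (S - {u, x, y, z})"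
        by (intro diff_card_le_card_Diff) auto
      moreover have "card {u, x, y, z} \<le> 4"
        using card_length[of "[u, x, y, z]"] by simp
      moreover have "card (S - {u, x, y, z}) \<le> card T" using that by (intro card_mono)
      ultimately show ?thesis using that(1) by linarith
    qed
    have slack_sub: "slack k G A - {u, x, y, z} \<subseteq> slack k ?G A"
      using nb(5) by (auto simp: slack_def)
    have "m \<le> card (outer_active ?G A) \<or>
        m \<le> card (slack k ?G A) \<and> nbrs ?G u \<inter> A \<subseteq> slack k ?G A"
    proof (cases "y \<in> A")
      case True
      \<comment> \<open>The remaining neighbours of \<open>u\<close> in \<open>A\<close> are none of
        the four altered vertices, so they keep their slack.\<close>
      have "nbrs ?G u \<inter> A \<subseteq> slack k G A - {u, x, y, z}"
        using slack_case[OF True] zu yu self[of u] by (auto simp: u_eq)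
      then have "nbrs ?G u \<inter> A \<subseteq> slack k ?G A" using slack_sub by blast
      moreover have "m \<le> card (slack k ?G A)"
        using slack_case[OF True] slack_sub fA
        by (intro card_Diff_four[of "slack k G A"]) (auto simp: slack_def)
      ultimately show ?thesis by blast
    next
      case False
      have "outer_active G A - {u, x, y, z} \<subseteq> outer_active ?G A"
        using nb(5) by (auto simp: outer_active_def)
      then show ?thesis
        using card_Diff_four[OF outer_case[OF False], of "outer_active ?G A"] fV
        by (auto simp: outer_active_def)
    qed
    ultimately have "reducible k m j ?G u"
      unfolding reducible_def using A(2,3) by auto
    with sw show ?thesis by blast
  qed
  ultimately show ?thesis using fY0 by (intro that[of "Y0 - ball" x]) auto
qed

text \<open>By resilience, both sides of a maximum cut have half of the vertices. If one side has
  \<open>w\<close> outer active vertices, every vertex of the opposite side qualifies. Otherwise few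
  vertices of \<open>A\<close> lack slack, and every vertex outside \<open>A\<close> that is
  adjacent to none of them qualifies.\<close>

lemma many_reducible_vertices:
  assumes G: "regular (2 * k + 1) G" and k: "k \<ge> 1" and res: "resilient k hamiltonian G"
    and n: "card (verts G) = 2 * ((2 * k + 2) * w)"
  shows "w \<le> card {u \<in> verts G. reducible k w (2 * k + 1) G u}"
proof -
  have sG: "simple_graph G" and deg: "\<And>v. v \<in> verts G \<Longrightarrow> card (nbrs G v) = 2 * k + 1"
    using G by (auto simp: regular_def)
  note fin = finite_nbrs[OF sG] and sub = nbrs_subset_verts[OF sG]
  have fV: "finite (verts G)" using sG by (simp add: simple_graph_def)
  let ?R = "{u \<in> verts G. reducible k w (2 * k + 1) G u}"
  have u_le: "card (nbrs G u \<inter> A) \<le> 2 * k + 1" if "u \<in> verts G" for u A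
    using card_mono[OF fin[of u], of "nbrs G u \<inter> A"] deg[OF that] by auto
  have outer_large: ?thesis
    if A: "sparse_set k G A" "2 * card A = card (verts G)" and w: "w \<le> card (outer_active G A)" for A
  proof -
    have "verts G - A \<subseteq> ?R"
      using A w u_le by (auto simp: reducible_def)
    then have "card (verts G - A) \<le> card ?R"
      using fV by (intro card_mono) auto
    moreover have "card (verts G - A) = card (verts G) - card A"
      using A fV by (intro card_Diff_subset) (auto simp: sparse_set_def intro: finite_subset)
    ultimately show ?thesis using A(2) n by simp
  qed
  obtain A where A: "A \<subseteq> verts G" "sparse_set k G A" "sparse_set k G (verts G - A)"
    using ex_sparse_bipartition[OF G] by blast
  define B where "B = verts G - A"
  have fA: "finite A" "finite B" using A(1) fV by (auto simp: B_def intro: finite_subset)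
  have "card B = card (verts G) - card A"
    unfolding B_def using A(1) fA by (intro card_Diff_subset)
  moreover have "card A \<le> card (verts G)" using A(1) fV by (rule card_mono[rotated])
  moreover have "2 * card A \<le> card (verts G)" "2 * card B \<le> card (verts G)"
    using not_resilient_if_large_sparse_set[OF sG] A(2,3) res by (auto simp: B_def not_less[symmetric])
  ultimately have half: "2 * card A = card (verts G)" "2 * card B = card (verts G)" by linarith+
  show ?thesis
  proof (cases "w \<le> card (outer_active G A) \<or> w \<le> card (outer_active G B)")
    case True
    then show ?thesis using outer_large A(2,3) half unfolding B_def by blast
  next
    case False
    \<comment> \<open>Now almost all edges cross the cut, so few vertices of \<open>A\<close> lack slack.\<close>
    define T where "T = A - slack k G A"
    have "T \<subseteq> outer_active G B"
    proof
      fix a assume a: "a \<in> T"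
      then have "nbrs G a \<inter> A \<noteq> {}" using k by (auto simp: T_def slack_def)
      then show "a \<in> outer_active G B"
        using a A(1) by (auto simp: T_def outer_active_def B_def)
    qed
    moreover have "finite (outer_active G B)" using fV by (simp add: outer_active_def)
    ultimately have "card T \<le> card (outer_active G B)" by (rule card_mono[rotated])
    then have Tw: "card T \<le> w" using False by simp
    have "card A - card T \<le> card (A - T)"
      using fA by (intro diff_card_le_card_Diff) (auto simp: T_def)
    also have "A - T = slack k G A" by (auto simp: T_def slack_def)
    finally have "card A - card T \<le> card (slack k G A)" .
    moreover have A_card: "card A = (2 * k + 2) * w" "card B = (2 * k + 2) * w"
      using half n by simp_all
    ultimately have slack_card: "w \<le> card (slack k G A)" using Tw by simp
    have "card (\<Union>t \<in> T. nbrs G t) \<le> (\<Sum>t \<in> T. card (nbrs G t))"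
      using fA by (intro card_UN_le) (auto simp: T_def)
    also have "\<dots> = (\<Sum>t \<in> T. 2 * k + 1)"
      using deg A(1) by (intro sum.cong) (auto simp: T_def)
    also have "\<dots> = card T * (2 * k + 1)" by simp
    also have "\<dots> \<le> w * (2 * k + 1)" using Tw by (rule mult_le_mono1)
    finally have "card (\<Union>t \<in> T. nbrs G t) \<le> w * (2 * k + 1)" .
    moreover have "card B - card (\<Union>t \<in> T. nbrs G t) \<le> card (B - (\<Union>t \<in> T. nbrs G t))"
      using fA fin by (intro diff_card_le_card_Diff) (auto simp: T_def)
    \<comment> \<open>At most \<open>(2 * k + 1) * w\<close> of the \<open>(2 * k + 2) * w\<close>
      vertices of \<open>B\<close> are excluded; this explains the factor \<open>2 * k + 2\<close>
      in the number of vertices.\<close>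
    ultimately have "w \<le> card (B - (\<Union>t \<in> T. nbrs G t))"
      using A_card by (simp add: algebra_simps)
    also have "B - (\<Union>t \<in> T. nbrs G t) \<subseteq> ?R"
    proof
      fix u assume u: "u \<in> B - (\<Union>t \<in> T. nbrs G t)"
      then have "nbrs G u \<inter> A \<subseteq> slack k G A"
        using nbrs_sym[of u G] by (auto simp: T_def)
      then show "u \<in> ?R"
        using u slack_card A(2) half(1) u_le by (auto simp: reducible_def B_def)
    qed
    then have "card (B - (\<Union>t \<in> T. nbrs G t)) \<le> card ?R"
      using fV by (intro card_mono) auto
    finally show ?thesis .
  qed
qed

section \<open>Double counting\<close>

text \<open>The vertex \<open>u\<close> stays fixed under all switchings. The set \<open>A\<close>
  is not recorded, so its choice costs no factor.\<close>

definition reducible_pairs :: "nat \<Rightarrow> nat \<Rightarrow> nat \<Rightarrow> nat \<Rightarrow> (nat ugraph \<times> nat) set" where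
  "reducible_pairs n k m j =
     (SIGMA G:regular_graphs n (2 * k + 1). {u \<in> {1..n}. reducible k m j G u})"

lemma mem_reducible_pairs_iff:
  "(G, u) \<in> reducible_pairs n k m j \<longleftrightarrow>
     regular (2 * k + 1) G \<and> verts G = {1..n} \<and> u \<in> {1..n} \<and> reducible k m j G u"
  by (simp add: reducible_pairs_def regular_graphs_eq)

lemma finite_reducible_pairs: "finite (reducible_pairs n k m j)"
  by (auto simp: reducible_pairs_def finite_regular_graphs)

text \<open>A pair not yet at level \<open>j\<close> has at least \<open>q\<close> switchings to
  that level, and each result arises in at most \<open>d * d * n\<close> ways. Pairs already at
  level \<open>j\<close> account for the summand \<open>q\<close> on the right.\<close>

lemma card_reducible_pairs_step:
  fixes n k q j :: nat
  defines "d \<equiv> 2 * k + 1"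
  defines "m \<equiv> q + (1 + d + d * d)"
  shows "card (reducible_pairs n k (m + 4) (Suc j)) * q
           \<le> card (reducible_pairs n k m j) * (q + d * d * n)"
proof -
  let ?S = "reducible_pairs n k m j" and ?S' = "reducible_pairs n k (m + 4) (Suc j)"
  define D where "D = ?S' - ?S"
  have "\<exists>x Y. finite Y \<and> q \<le> card Y \<and> (\<forall>y \<in> Y. \<exists>z.
     switchable (fst p) (snd p) x y z \<and> reducible k m j (switch (fst p) (snd p) x y z) (snd p))"
    if p: "p \<in> D" for p
  proof -
    have "regular d (fst p)" "reducible k (m + 4) (Suc j) (fst p) (snd p)"
      "\<not> reducible k m j (fst p) (snd p)"
      using p mem_reducible_pairs_iff[of "fst p" "snd p"] by (simp_all add: D_def d_def)
    from reducible_step[OF this[unfolded d_def]] obtain x Y where "finite Y"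
      "m \<le> card Y + (1 + d + d * d)"
      "\<And>y. y \<in> Y \<Longrightarrow> \<exists>z. switchable (fst p) (snd p) x y z \<and>
         reducible k m j (switch (fst p) (snd p) x y z) (snd p)"
      unfolding d_def by metis
    moreover from this(2) have "q \<le> card Y" by (simp add: m_def)
    ultimately show ?thesis by blast
  qed
  then obtain X Y where Y: "\<And>p. p \<in> D \<Longrightarrow> finite (Y p)" "\<And>p. p \<in> D \<Longrightarrow> q \<le> card (Y p)"
    and ex_Z: "\<And>p y. p \<in> D \<Longrightarrow> y \<in> Y p \<Longrightarrow> \<exists>z. switchable (fst p) (snd p) (X p) y z \<and>
      reducible k m j (switch (fst p) (snd p) (X p) y z) (snd p)"
    by metis
  \<comment> \<open>One \<open>z\<close> for each \<open>y\<close> is enough, since the lower bound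
    counts only the choices of \<open>y\<close>.\<close>
  define Z where "Z p y = (SOME z. switchable (fst p) (snd p) (X p) y z \<and>
    reducible k m j (switch (fst p) (snd p) (X p) y z) (snd p))" for p y
  have Z_spec: "switchable (fst p) (snd p) (X p) y (Z p y) \<and>
    reducible k m j (switch (fst p) (snd p) (X p) y (Z p y)) (snd p)" if "p \<in> D" "y \<in> Y p" for p y
    unfolding Z_def using ex_Z[OF that] by (rule someI_ex)
  note Z = Z_spec[THEN conjunct1] Z_spec[THEN conjunct2]
  \<comment> \<open>The recorded vertices determine the reverse switching, which makes \<open>f\<close> injective.\<close>
  define f where "f = (\<lambda>(p, y). ((switch (fst p) (snd p) (X p) y (Z p y), snd p), Z p y, X p, y))"
  \<comment> \<open>After the switching, \<open>z\<close> is a neighbour of \<open>u\<close> and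
    \<open>y\<close> is one of \<open>x\<close>, which gives two factors \<open>d\<close>; for
    \<open>x\<close> any of the \<open>n\<close> vertices is allowed.\<close>
  define target where
    "target = (SIGMA r:?S. SIGMA z:nbrs (fst r) (snd r). SIGMA x:{1..n}. nbrs (fst r) x)"
  have reg: "regular d (fst r)" "verts (fst r) = {1..n}" "snd r \<in> {1..n}" if "r \<in> ?S" for r
    using that mem_reducible_pairs_iff[of "fst r" "snd r" n k m j] by (simp_all add: d_def)
  have regD: "regular d (fst p)" "verts (fst p) = {1..n}" "snd p \<in> {1..n}" if "p \<in> D" for p
    using that mem_reducible_pairs_iff[of "fst p" "snd p" n k "m + 4" "Suc j"]
    by (simp_all add: D_def d_def)
  have fin_nbrs: "finite (nbrs (fst r) v)" if "r \<in> ?S" for r v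
    using reg(1)[OF that] by (intro finite_nbrs) (simp add: regular_def)
  have "inj_on f (SIGMA p:D. Y p)"
  proof (rule inj_onI)
    fix a b assume "a \<in> (SIGMA p:D. Y p)" "b \<in> (SIGMA p:D. Y p)" and eq: "f a = f b"
    then obtain p y p' y' where ab: "a = (p, y)" "b = (p', y')"
      and p: "p \<in> D" "y \<in> Y p" "p' \<in> D" "y' \<in> Y p'" by blast
    have eqs: "switch (fst p) (snd p) (X p) y (Z p y) = switch (fst p') (snd p') (X p') y' (Z p' y')"
      "snd p = snd p'" "Z p y = Z p' y'" "X p = X p'" "y = y'"
      using eq by (auto simp: f_def ab)
    have "fst p = switch (switch (fst p) (snd p) (X p) y (Z p y)) (snd p) (Z p y) y (X p)"
      using switch_switch[OF Z(1)[OF p(1,2)]] by simp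
    also have "\<dots> = fst p'"
      using switch_switch[OF Z(1)[OF p(3,4)]] eqs by simp
    finally show "a = b" using eqs ab by (simp add: prod_eq_iff)
  qed
  moreover have "f ` (SIGMA p:D. Y p) \<subseteq> target"
  proof
    fix t assume "t \<in> f ` (SIGMA p:D. Y p)"
    then obtain p y where p: "p \<in> D" "y \<in> Y p" and t: "t = f (p, y)" by blast
    note sw = Z(1)[OF p]
    let ?G = "switch (fst p) (snd p) (X p) y (Z p y)"
    have "X p \<in> nbrs (fst p) (snd p)" using sw by (simp add: switchable_def)
    then have "X p \<in> {1..n}"
      using regD[OF p(1)] nbrs_subset_verts[of "fst p" "snd p"] by (auto simp: regular_def)
    moreover have "(?G, snd p) \<in> ?S"
      using regular_switch[OF regD(1)[OF p(1)] sw] regD[OF p(1)] Z(2)[OF p]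
      by (simp add: mem_reducible_pairs_iff d_def)
    ultimately show "t \<in> target"
      unfolding t f_def target_def by (auto simp: nbrs_switch[OF sw])
  qed
  moreover have "finite target"
    unfolding target_def using finite_reducible_pairs fin_nbrs by (intro finite_SigmaI) auto
  ultimately have "card (SIGMA p:D. Y p) \<le> card target"
    by (rule card_inj_on_le)
  moreover have "card D * q \<le> card (SIGMA p:D. Y p)"
  proof -
    have "card D * q = (\<Sum>p \<in> D. q)" by simp
    also have "\<dots> \<le> (\<Sum>p \<in> D. card (Y p))" using Y(2) by (rule sum_mono)
    also have "\<dots> = card (SIGMA p:D. Y p)"
      using Y(1) finite_reducible_pairs by (subst card_SigmaI) (auto simp: D_def)
    finally show ?thesis .
  qed
  moreover have "card target = card ?S * (d * d * n)"
  proof -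
    have "card (SIGMA z:nbrs (fst r) (snd r). SIGMA x:{1..n}. nbrs (fst r) x) = d * d * n"
      if r: "r \<in> ?S" for r
    proof -
      have "card (SIGMA x:{1..n}. nbrs (fst r) x) = (\<Sum>x \<in> {1..n}. card (nbrs (fst r) x))"
        using fin_nbrs[OF r] by (intro card_SigmaI) auto
      also have "\<dots> = (\<Sum>x \<in> {1..n}. d)"
        using reg[OF r] by (intro sum.cong) (auto simp: regular_def)
      finally show ?thesis
        using reg[OF r] by (simp add: card_cartesian_product regular_def)
    qed
    moreover have "card target = (\<Sum>r \<in> ?S. card (SIGMA z:nbrs (fst r) (snd r). SIGMA x:{1..n}. nbrs (fst r) x))"
      unfolding target_def using finite_reducible_pairs fin_nbrs by (intro card_SigmaI) auto
    ultimately show ?thesis by simp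
  qed
  ultimately have "card D * q \<le> card ?S * (d * d * n)" by linarith
  moreover have "card ?S' \<le> card D + card ?S"
    unfolding D_def using diff_card_le_card_Diff[OF finite_reducible_pairs, of ?S' n k m j] by linarith
  then have "card ?S' * q \<le> (card D + card ?S) * q" by (rule mult_le_mono1)
  ultimately show ?thesis by (simp add: algebra_simps)
qed

text \<open>As \<open>n\<close> is proportional to \<open>s\<close> and each step has at least
  \<open>s\<close> choices, a step costs a factor independent of \<open>n\<close>. The summand
  \<open>4 * j\<close> pays for the four vertices lost in each step.\<close>

lemma card_reducible_pairs_le:
  fixes k s j :: nat
  defines "d \<equiv> 2 * k + 1"
  defines "n \<equiv> 4 * ((d + 1) * s)"
  defines "m \<equiv> s + (1 + d + d * d)"
  assumes s: "s > 0"
  shows "card (reducible_pairs n k (m + 4 * j) j)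
           \<le> (1 + 4 * (d * d * (d + 1))) ^ j * card (reducible_pairs n k m 0)"
proof (induction j)
  case (Suc j)
  let ?K = "1 + 4 * (d * d * (d + 1))"
  have m_eq: "m + 4 * j = (s + 4 * j) + (1 + d + d * d)" by (simp add: m_def)
  have "card (reducible_pairs n k (m + 4 * j + 4) (Suc j)) * (s + 4 * j)
      \<le> card (reducible_pairs n k (m + 4 * j) j) * ((s + 4 * j) + d * d * n)"
    using card_reducible_pairs_step[of n k "s + 4 * j" j] unfolding m_eq d_def .
  also have "(s + 4 * j) + d * d * n \<le> ?K * (s + 4 * j)"
    by (simp add: n_def algebra_simps)
  finally have "card (reducible_pairs n k (m + 4 * j + 4) (Suc j)) * (s + 4 * j)
      \<le> (card (reducible_pairs n k (m + 4 * j) j) * ?K) * (s + 4 * j)"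
    by (simp only: mult.assoc mult_le_mono2)
  then have "card (reducible_pairs n k (m + 4 * j + 4) (Suc j))
      \<le> card (reducible_pairs n k (m + 4 * j) j) * ?K"
    using s by (subst (asm) mult_le_cancel2) linarith
  also have "\<dots> \<le> (?K ^ j * card (reducible_pairs n k m 0)) * ?K"
    using Suc.IH by (rule mult_le_mono1)
  finally show ?case by (simp add: algebra_simps)
qed simp

text \<open>A resilient graph yields at least \<open>2 * s\<close> pairs at level \<open>d\<close>,
  a non-resilient one at most \<open>n\<close> pairs at level 0. Since
  \<open>n = 2 * (d + 1) * (2 * s)\<close>, the factor \<open>2 * s\<close> cancels and the constant
  does not depend on \<open>n\<close>.\<close>

lemma card_resilient_le:
  fixes k s :: nat
  defines "d \<equiv> 2 * k + 1"
  defines "n \<equiv> 4 * ((d + 1) * s)"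
  defines "\<G> \<equiv> regular_graphs n d"
  assumes k: "k \<ge> 1" and s: "s \<ge> 1 + d + d * d + 4 * d"
  shows "card {G \<in> \<G>. resilient k hamiltonian G}
    \<le> 2 * (d + 1) * (1 + 4 * (d * d * (d + 1))) ^ d * card {G \<in> \<G>. \<not> resilient k hamiltonian G}"
proof -
  let ?R = "{G \<in> \<G>. resilient k hamiltonian G}" and ?N = "{G \<in> \<G>. \<not> resilient k hamiltonian G}"
  let ?K = "1 + 4 * (d * d * (d + 1))"
  define m where "m = s + (1 + d + d * d)"
  have fin: "finite \<G>" by (simp add: \<G>_def finite_regular_graphs)
  have many: "2 * s \<le> card {u \<in> {1..n}. reducible k (m + 4 * d) d G u}" if G: "G \<in> ?R" for G
  proof -
    have G': "regular (2 * k + 1) G" "verts G = {1..n}" "resilient k hamiltonian G"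
      using G by (auto simp: \<G>_def regular_graphs_eq d_def)
    have "2 * s \<le> card {u \<in> verts G. reducible k (2 * s) (2 * k + 1) G u}"
      using G' k by (intro many_reducible_vertices) (auto simp: n_def d_def)
    also have "\<dots> \<le> card {u \<in> {1..n}. reducible k (m + 4 * d) d G u}"
    proof (rule card_mono)
      \<comment> \<open>The assumed lower bound on \<open>s\<close> is equivalent to this
        inequality.\<close>
      have "m + 4 * d \<le> 2 * s" using s by (simp add: m_def)
      then show "{u \<in> verts G. reducible k (2 * s) (2 * k + 1) G u}
          \<subseteq> {u \<in> {1..n}. reducible k (m + 4 * d) d G u}"
        unfolding G'(2) d_def by (auto elim: reducible_mono)
    qed simp
    finally show ?thesis .
  qed
  have "card ?R * (2 * s) = (\<Sum>G \<in> ?R. 2 * s)" by simp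
  also have "\<dots> \<le> (\<Sum>G \<in> ?R. card {u \<in> {1..n}. reducible k (m + 4 * d) d G u})"
    using many by (rule sum_mono)
  also have "\<dots> \<le> (\<Sum>G \<in> \<G>. card {u \<in> {1..n}. reducible k (m + 4 * d) d G u})"
    using fin by (intro sum_mono2) auto
  also have "\<dots> = card (reducible_pairs n k (m + 4 * d) d)"
    unfolding reducible_pairs_def using fin by (subst card_SigmaI) (auto simp: \<G>_def d_def)
  also have "\<dots> \<le> ?K ^ d * card (reducible_pairs n k m 0)"
    using card_reducible_pairs_le[of s k d] s unfolding n_def d_def m_def by simp
  also have "card (reducible_pairs n k m 0) \<le> card (?N \<times> {1..n})"
  proof (rule card_mono)
    show "reducible_pairs n k m 0 \<subseteq> ?N \<times> {1..n}"
      using fin by (auto simp: reducible_pairs_def \<G>_def regular_graphs_eq regular_def d_def dest: not_resilient_if_reducible_0)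
  qed (use fin in auto)
  also have "card (?N \<times> {1..n}) = card ?N * (2 * (d + 1) * (2 * s))"
    by (simp add: card_cartesian_product n_def)
  finally have "card ?R * (2 * s) \<le> (2 * (d + 1) * ?K ^ d * card ?N) * (2 * s)"
    by (simp add: algebra_simps)
  then show ?thesis using s by simp
qed

text \<open>\<^const>\<open>random_regular_graph\<close> is unspecified when there are no regular graphs. Here the components
  are complete graphs on the blocks of \<open>d + 1\<close> consecutive vertices.\<close>
lemma regular_graphs_nonempty: "regular_graphs ((d + 1) * t) d \<noteq> {}"
proof -
  define n where "n = (d + 1) * t"
  define G where "G = ({1..n}, {{x, y} | x y. x \<in> {1..n} \<and> y \<in> {1..n} \<and> x \<noteq> y \<and>
    (x - 1) div (d + 1) = (y - 1) div (d + 1)})"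
  have "simple_graph G" by (auto simp: simple_graph_def G_def card_2_iff)
  moreover have "card (nbrs G v) = d" if v: "v \<in> {1..n}" for v
  proof -
    define b where "b = (v - 1) div (d + 1)"
    have "b < t" using v less_mult_imp_div_less[of "v - 1" t "d + 1"]
      by (auto simp: b_def n_def mult.commute)
    then have "(b + 1) * (d + 1) \<le> t * (d + 1)" by (intro mult_le_mono1) simp
    then have bn: "b * (d + 1) + (d + 1) \<le> n" by (simp add: n_def algebra_simps)
    \<comment> \<open>Truncated subtraction would put \<open>y = 0\<close> into the first block as
      well, hence the restriction to positive \<open>y\<close>.\<close>
    have div_iff: "(y - 1) div (d + 1) = b \<longleftrightarrow> y \<in> {b * (d + 1) + 1..b * (d + 1) + (d + 1)}"
      if "y \<ge> 1" for y
    proof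
      assume "(y - 1) div (d + 1) = b"
      then have "b * (d + 1) + (y - 1) mod (d + 1) = y - 1"
        using div_mult_mod_eq[of "y - 1" "d + 1"] by metis
      moreover have "(y - 1) mod (d + 1) < d + 1" by (rule mod_less_divisor) simp
      ultimately have "b * (d + 1) + 1 \<le> y" "y \<le> b * (d + 1) + (d + 1)"
        using that by linarith+
      then show "y \<in> {b * (d + 1) + 1..b * (d + 1) + (d + 1)}" by simp
    next
      assume "y \<in> {b * (d + 1) + 1..b * (d + 1) + (d + 1)}"
      then show "(y - 1) div (d + 1) = b"
        by (intro div_nat_eqI) (auto simp: algebra_simps)
    qed
    have "nbrs G v = {y \<in> {1..n}. (y - 1) div (d + 1) = b} - {v}"
      using v by (auto simp: nbrs_def G_def b_def doubleton_eq_iff)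
    also have "{y \<in> {1..n}. (y - 1) div (d + 1) = b} = {b * (d + 1) + 1..b * (d + 1) + (d + 1)}"
    proof (rule set_eqI)
      fix y
      show "y \<in> {y \<in> {1..n}. (y - 1) div (d + 1) = b} \<longleftrightarrow>
          y \<in> {b * (d + 1) + 1..b * (d + 1) + (d + 1)}"
      proof (cases "y \<ge> 1")
        case True
        then show ?thesis unfolding mem_Collect_eq div_iff[OF True] using bn by auto
      qed auto
    qed
    finally have "nbrs G v = {b * (d + 1) + 1..b * (d + 1) + (d + 1)} - {v}" .
    moreover have "v \<in> {b * (d + 1) + 1..b * (d + 1) + (d + 1)}"
      using v by (subst div_iff[symmetric]) (simp_all add: b_def)
    ultimately show ?thesis by simp
  qed
  ultimately have "G \<in> regular_graphs n d"
    by (auto simp: regular_graphs_eq regular_def G_def)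
  then show ?thesis by (auto simp: n_def)
qed

section \<open>From the counting bound to the limit\<close>

theorem theorem1p3:
  fixes d :: nat
  assumes "odd d" and "d > 2"
  shows "\<not> aas d (resilient ((d - 1) div 2) hamiltonian)"
proof
  assume aas: "aas d (resilient ((d - 1) div 2) hamiltonian)"
  define k where "k = (d - 1) div 2"
  have k: "d = 2 * k + 1" "k \<ge> 1" using assms by (auto simp: k_def)
  let ?Q = "{G. resilient k hamiltonian G}"
  let ?p = "\<lambda>n. measure_pmf.prob (random_regular_graph n d) ?Q"
  define L where "L = 2 * (d + 1) * (1 + 4 * (d * d * (d + 1))) ^ d"
  have "(?p \<longlongrightarrow> 1) (admissible_sizes d)" using aas by (simp add: aas_def k_def)
  \<comment> \<open>If resilient graphs are at most \<open>L\<close> times as many as the others,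
    their proportion is at most \<open>L / (L + 1)\<close>, which a sequence tending to 1 eventually
    exceeds.\<close>
  then have "\<forall>\<^sub>F n in admissible_sizes d. real L / (real L + 1) < ?p n"
    by (rule order_tendstoD) simp
  then obtain n0 where n0: "\<And>n. n \<ge> n0 \<Longrightarrow> d < n \<Longrightarrow> even (n * d) \<Longrightarrow> real L / (real L + 1) < ?p n"
    by (auto simp: admissible_sizes_def eventually_inf_principal eventually_sequentially)
  \<comment> \<open>This \<open>s\<close> is at least \<open>n0\<close> and satisfies the bound in
    \<open>card_resilient_le\<close>. The resulting \<open>n\<close> is even and a multiple of
    \<open>d + 1\<close>, so regular graphs exist.\<close>
  define s where "s = n0 + (1 + d + d * d + 4 * d)"
  define n where "n = 4 * ((d + 1) * s)"
  let ?\<G> = "regular_graphs n d"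
  have "s \<le> n" by (simp add: n_def)
  then have "real L / (real L + 1) < ?p n"
    by (intro n0) (auto simp: s_def n_def)
  also have ne: "?\<G> \<noteq> {}"
    using regular_graphs_nonempty[of d "4 * s"] by (simp add: n_def algebra_simps)
  have "?p n = real (card (?\<G> \<inter> ?Q)) / real (card ?\<G>)"
    unfolding random_regular_graph_def using ne finite_regular_graphs
    by (rule measure_pmf_of_set)
  finally have "real L * real (card ?\<G>) < real (card (?\<G> \<inter> ?Q)) * (real L + 1)"
    using ne finite_regular_graphs by (simp add: field_simps card_gt_0_iff)
  moreover have "card (?\<G> \<inter> ?Q) \<le> L * card (?\<G> - ?Q)"
    using card_resilient_le[of k s] k unfolding L_def n_def s_def
    by (auto simp: Int_def Diff_eq set_diff_eq)
  then have "real (card (?\<G> \<inter> ?Q)) \<le> real L * real (card (?\<G> - ?Q))"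
    by (metis of_nat_le_iff of_nat_mult)
  moreover have "real (card ?\<G>) = real (card (?\<G> \<inter> ?Q)) + real (card (?\<G> - ?Q))"
    using card_Int_Diff[OF finite_regular_graphs, of n d ?Q] by simp
  ultimately show False by (simp add: algebra_simps)
qed

end
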